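(* For any nonnegative integer $v$ and any positive integer $n$, $$\sum_{k=0}^{n-1}q^{(n-1-k)(2v+1)}\,[2k+1]^{2v+1}\,D_k(q)\equiv0\pmod{[n]}.$$
   Context: $q$ is an indeterminate and $[m]=\frac{1-q^m}{1-q}$ for $m\in\mathbb{Z}$. The $q$-binomial coefficient is $\left[\begin{matrix}m\\ k\end{matrix}\right]=\frac{\prod_{1\le j\le k}[m-j+1]}{\prod_{1\le j\le k}[j]}$ for $k\geq 1$, $\left[\begin{matrix}m\\0\end{matrix}\right]=1$. The $q$-central Delannoy numbers are $$D_n(q)=\sum_{k=0}^{n}q^{\binom{k}{2}-kn}\left[\begin{matrix}n\\k\end{matrix}\right]\left[\begin{matrix}n+k\\k\end{matrix}\right]\in\mathbb{Z}[q,q^{-1}].$$ The congruence means divisibility by $[n]$ in $\mathbb{Z}[q,q^{-1}]$. *)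

theory Defs
  imports "HOL-Computational_Algebra.Polynomial_Factorial"
begin

text \<open>
  Everything lives in the field of fractions of \<open>\<int>[q]\<close>, that is \<open>\<rat>(q)\<close>, in which the divisions
  below are genuine; \<open>\<int>[q, q\<^sup>-\<^sup>1]\<close> is a subring of that field.
\<close>

type_synonym ratfun = "int poly fract"

definition q :: ratfun where
  "q = to_fract [:0, 1:]"

definition laurent_polys :: "ratfun set" where
  "laurent_polys = {to_fract p / q ^ n | (p :: int poly) (n :: nat). True}"

definition qint :: "int \<Rightarrow> ratfun" where
  "qint m = (1 - q powi m) / (1 - q)"

definition qbinom :: "int \<Rightarrow> nat \<Rightarrow> ratfun" where
  "qbinom m k = (\<Prod>j=1..k. qint (m - int j + 1)) / (\<Prod>j=1..k. qint (int j))"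

definition qdelannoy :: "nat \<Rightarrow> ratfun" where
  "qdelannoy n =
    (\<Sum>k=0..n. q powi (int (k choose 2) - int k * int n) * qbinom (int n) k * qbinom (int (n + k)) k)"

text \<open>
  The quotient \<open>d\<close> has to be a Laurent polynomial with integer coefficients: in the ambient
  field, divisibility by a nonzero element would be vacuous.
\<close>

definition laurent_cong :: "ratfun \<Rightarrow> ratfun \<Rightarrow> ratfun \<Rightarrow> bool" where
  "laurent_cong a b m \<longleftrightarrow>
    a \<in> laurent_polys \<and> b \<in> laurent_polys \<and> m \<in> laurent_polys \<and>
    (\<exists>d \<in> laurent_polys. a - b = m * d)"

end

theory Submission
  imports Defs
begin

text \<open>
  Expand \<open>D\<^sub>k(q)\<close> as the sum over \<open>j\<close> of \<open>q\<close> to the power \<open>j choose 2\<close> times \<open>T\<^sub>j(k)\<close>, where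
  \<open>T\<^sub>j(k)\<close> (\<open>dterm j k\<close> below) is \<open>q\<^bsup>-jk\<^esup>\<close> times the \<open>q\<close>-binomials of \<open>k\<close> over \<open>j\<close> and of
  \<open>k + j\<close> over \<open>j\<close>. Up to a factor that does not depend on \<open>k\<close>, \<open>T\<^sub>j(k)\<close> is a product of \<open>j\<close>
  factors \<open>q\<^bsup>-k\<^esup> [k + i] [k + 1 - i]\<close>, each of which differs from \<open>x\<^sub>k = q\<^bsup>-k\<^esup> [k] [k + 1]\<close>
  by a constant. So multiplication by \<open>x\<^sub>k\<close> maps \<open>T\<^sub>j\<close> to a combination of \<open>T\<^sub>j\<close> and \<open>T\<^sub>j\<^sub>+\<^sub>1\<close>
  whose coefficients are Laurent polynomials independent of \<open>k\<close> (\<open>dvar_mult_dterm\<close>).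

  Two further facts finish the proof. The square of \<open>q\<^bsup>-k\<^esup> [2k + 1]\<close> is a polynomial in \<open>x\<^sub>k\<close>
  over \<open>\<int>[q]\<close> (\<open>odd_qint_square\<close>), so the factor \<open>[2k + 1]\<^bsup>2v\<^esup>\<close>, suitably scaled, only replaces
  the \<open>T\<^sub>j\<close> by combinations of them. And for a single remaining factor the sum over \<open>k < n\<close> of
  \<open>q\<^bsup>-k\<^esup> [2k + 1] T\<^sub>j(k)\<close> telescopes to \<open>[n]\<close> times a Laurent polynomial
  (\<open>weighted_sum_dterm\<close>). That cofactor is a power of \<open>q\<close> times two \<open>q\<close>-binomials, and
  the \<open>q\<close>-Pascal rule shows that \<open>q\<close>-binomials are Laurent polynomials.
\<close>

section \<open>The ring of Laurent polynomials\<close>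

lemma q_power_eq: "q ^ n = to_fract ([:0, 1:] ^ n)"
proof (induction n)
  case (Suc n)
  thus ?case
    by (simp only: power_Suc to_fract_mult q_def)
qed simp

lemma q_nonzero [simp]: "q \<noteq> 0"
  by (simp add: q_def)

lemma q_power_neq_1:
  assumes "n > 0"
  shows "q ^ n \<noteq> 1"
proof
  assume "q ^ n = 1"
  hence "to_fract ([:0, 1:] ^ n :: int poly) = to_fract 1"
    by (simp only: q_power_eq to_fract_1)
  hence "([:0, 1:] ^ n :: int poly) = 1"
    by (simp only: to_fract_eq_iff)
  hence "poly ([:0, 1:] ^ n :: int poly) 0 = 1"
    by simp
  thus False
    using assms by (simp add: power_0_left)
qed

lemma q_neq_1 [simp]: "q \<noteq> 1" "1 \<noteq> q"
  using q_power_neq_1[of 1] by auto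

lemma laurent_to_fract [intro]: "to_fract p \<in> laurent_polys"
  unfolding laurent_polys_def by (rule CollectI, rule exI[of _ p], rule exI[of _ 0]) simp

lemma laurent_0 [intro, simp]: "0 \<in> laurent_polys"
  using laurent_to_fract[of 0] by simp

lemma laurent_1 [intro, simp]: "1 \<in> laurent_polys"
  using laurent_to_fract[of 1] by simp

lemma laurent_add [intro]:
  assumes "a \<in> laurent_polys" "b \<in> laurent_polys"
  shows "a + b \<in> laurent_polys"
proof -
  from assms obtain p r m n where
    a: "a = to_fract p / q ^ m" and b: "b = to_fract r / q ^ n"
    by (auto simp: laurent_polys_def)
  have "a + b = to_fract (p * [:0, 1:] ^ n + r * [:0, 1:] ^ m) / q ^ (m + n)"
    by (simp add: a b to_fract_add to_fract_mult q_power_eq [symmetric] power_add field_simps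
        del: mult_pCons_right mult_pCons_left)
  thus ?thesis
    unfolding laurent_polys_def by blast
qed

lemma laurent_mult [intro]:
  assumes "a \<in> laurent_polys" "b \<in> laurent_polys"
  shows "a * b \<in> laurent_polys"
proof -
  from assms obtain p r m n where
    a: "a = to_fract p / q ^ m" and b: "b = to_fract r / q ^ n"
    by (auto simp: laurent_polys_def)
  have "a * b = to_fract (p * r) / q ^ (m + n)"
    by (simp add: a b power_add)
  thus ?thesis
    unfolding laurent_polys_def by blast
qed

lemma laurent_q_powi [intro, simp]: "q powi m \<in> laurent_polys"
proof (cases "m \<ge> 0")
  case True
  hence "q powi m = to_fract ([:0, 1:] ^ nat m)"
    by (simp add: power_int_def q_power_eq)
  thus ?thesis
    by auto
next
  case False
  hence "q powi m = to_fract 1 / q ^ nat (- m)"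
    by (simp add: power_int_def field_simps)
  thus ?thesis
    unfolding laurent_polys_def by blast
qed

lemma laurent_q_power [intro, simp]: "q ^ m \<in> laurent_polys"
  by (simp add: q_power_eq laurent_to_fract)

lemma laurent_q [intro, simp]: "q \<in> laurent_polys"
  using laurent_q_power[of 1] by simp

lemma laurent_uminus [intro]: "a \<in> laurent_polys \<Longrightarrow> - a \<in> laurent_polys"
  using laurent_mult[OF laurent_to_fract[of "-1"], of a] by simp

lemma laurent_power [intro]: "a \<in> laurent_polys \<Longrightarrow> a ^ m \<in> laurent_polys"
  by (induction m) auto

section \<open>Arithmetic of q-integers and q-binomials\<close>

lemma qint_0 [simp]: "qint 0 = 0"
  by (simp add: qint_def)

lemma qint_1 [simp]: "qint 1 = 1"
  by (simp add: qint_def)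

lemma qint_add: "qint (a + b) = qint a + q powi a * qint b"
  by (simp add: qint_def power_int_add field_simps)

lemma qint_Suc_nonzero [simp]: "qint (1 + int k) \<noteq> 0" "qint (int k + 1) \<noteq> 0"
  using q_power_neq_1[of "Suc k"]
  by (auto simp: qint_def power_int_add power_int_of_nat mult.commute)

lemma laurent_qint [intro, simp]: "qint (int n) \<in> laurent_polys"
proof (induction n)
  case (Suc n)
  have "qint (int (Suc n)) = qint 1 + q powi 1 * qint (int n)"
    using qint_add[of 1 "int n"] by simp
  with Suc show ?case
    by auto
qed simp

lemma laurent_qint_Suc [intro, simp]: "qint (1 + int n) \<in> laurent_polys"
  using laurent_qint[of "Suc n"] by simp

lemma qbinom_0_right [simp]: "qbinom m 0 = 1"
  by (simp add: qbinom_def)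

lemma qbinom_Suc_right: "qbinom m (Suc k) * qint (1 + int k) = qbinom m k * qint (m - int k)"
  by (simp add: qbinom_def)

lemma qbinom_Suc_Suc: "qbinom (m + 1) (Suc k) * qint (1 + int k) = qbinom m k * qint (m + 1)"
proof -
  have "(\<Prod>j=1..Suc k. qint (m + 1 - int j + 1)) = qint (m + 1) * (\<Prod>j=1..k. qint (m - int j + 1))"
    by (subst prod.atLeast_Suc_atMost)
      (simp_all add: prod.shift_bounds_cl_Suc_ivl algebra_simps del: prod.cl_ivl_Suc)
  thus ?thesis
    by (simp add: qbinom_def)
qed

lemma qbinom_Suc_left:
  "qbinom (m + 1) k * qint (m + 1 - int k) = qbinom m k * qint (m + 1)"
  using qbinom_Suc_right[of "m + 1" k] qbinom_Suc_Suc[of m k] by simp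

lemma qbinom_pascal:
  "qbinom (m + 1) (Suc k) = qbinom m k + q powi (1 + int k) * qbinom m (Suc k)"
proof -
  have "qint (m + 1) = qint (1 + int k) + q powi (1 + int k) * qint (m - int k)"
    using qint_add[of "1 + int k" "m - int k"] by (simp add: add.commute)
  hence "qbinom (m + 1) (Suc k) * qint (1 + int k)
      = (qbinom m k + q powi (1 + int k) * qbinom m (Suc k)) * qint (1 + int k)"
    unfolding qbinom_Suc_Suc by (simp add: algebra_simps qbinom_Suc_right)
  thus ?thesis
    by simp
qed

lemma qbinom_0_Suc [simp]: "qbinom 0 (Suc k) = 0"
  using qbinom_Suc_Suc[of "-1" k] by simp

lemma qbinom_eq_0: "n < k \<Longrightarrow> qbinom (int n) k = 0"
proof (induction n arbitrary: k)
  case 0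
  thus ?case
    by (cases k) auto
next
  case (Suc n)
  then obtain k' where "k = Suc k'" "n < k'"
    by (cases k) auto
  thus ?case
    using qbinom_pascal[of "int n" k'] Suc.IH[of k'] Suc.IH[of "Suc k'"]
    by (simp add: add.commute)
qed

text \<open>
  The \<open>q\<close>-Pascal rule has no denominators, which makes the induction go through.
\<close>

lemma laurent_qbinom [intro, simp]: "qbinom (int n) k \<in> laurent_polys"
proof (induction n arbitrary: k)
  case 0
  show ?case
    by (cases k) auto
next
  case (Suc n)
  show ?case
  proof (cases k)
    case (Suc k')
    thus ?thesis
      using qbinom_pascal[of "int n" k'] Suc.IH[of k'] Suc.IH[of "Suc k'"]
      by (auto simp: add.commute)
  qed auto
qed

section \<open>The summands of the central Delannoy numbers\<close>

text \<open>
  The power \<open>j choose 2\<close> of \<open>q\<close> is left out: it does not depend on \<open>k\<close>.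
\<close>

definition dterm :: "nat \<Rightarrow> nat \<Rightarrow> ratfun" where
  "dterm j k = q powi (- (int k * int j)) * qbinom (int k) j * qbinom (int (k + j)) j"

definition dvar :: "nat \<Rightarrow> ratfun" where
  "dvar k = q powi (- int k) * qint (int k) * qint (1 + int k)"

text \<open>
  Since \<open>dterm j k\<close> vanishes for \<open>j > k\<close>, the range of \<open>j\<close> can be made independent of \<open>k\<close>,
  so that the two sums can be interchanged.
\<close>

lemma qdelannoy_eq_dterm:
  assumes "k < n"
  shows "qdelannoy k = (\<Sum>j<n. q ^ (j choose 2) * dterm j k)"
proof -
  have "qdelannoy k = (\<Sum>j=0..k. q ^ (j choose 2) * dterm j k)"
    unfolding qdelannoy_def dterm_def
    by (intro sum.cong refl)
      (simp add: power_int_diff power_int_minus power_int_of_nat field_simps)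
  also have "\<dots> = (\<Sum>j<n. q ^ (j choose 2) * dterm j k)"
    using assms by (intro sum.mono_neutral_left) (auto simp: dterm_def qbinom_eq_0)
  finally show ?thesis .
qed

lemma dterm_Suc:
  "qint (1 + int j) ^ 2 * dterm (Suc j) k
     = q powi (- int k) * qint (int k - int j) * qint (1 + int k + int j) * dterm j k"
proof -
  have top: "qbinom (int (k + Suc j)) (Suc j) * qint (1 + int j)
      = qbinom (int (k + j)) j * qint (1 + int k + int j)"
    using qbinom_Suc_Suc[of "int (k + j)" j] by (simp add: algebra_simps)
  have pow: "q powi (- (int k * int (Suc j))) = q powi (- int k) * q powi (- (int k * int j))"
    by (simp add: power_int_add [symmetric] algebra_simps)
  have "qint (1 + int j) ^ 2 * dterm (Suc j) k
      = q powi (- int k) * q powi (- (int k * int j)) * (qbinom (int k) (Suc j) * qint (1 + int j))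
        * (qbinom (int (k + Suc j)) (Suc j) * qint (1 + int j))"
    unfolding dterm_def pow by (simp only: power2_eq_square mult_ac)
  thus ?thesis
    unfolding top qbinom_Suc_right[of "int k"] dterm_def by (simp only: mult_ac)
qed

lemma dvar_shift:
  "dvar k = q powi (- int k) * qint (int k - int j) * qint (1 + int k + int j)
     + q powi (- int j) * qint (int j) * qint (1 + int j)"
proof -
  define a ai b bi u where "a = q powi int k" and "ai = q powi (- int k)"
    and "b = q powi int j" and "bi = q powi (- int j)" and "u = inverse (1 - q)"
  note defs = this
  have "a * ai = 1" "b * bi = 1"
    by (simp_all add: defs power_int_minus)
  hence "ai * ((1 - a) * u) * ((1 - q * a) * u) =
      ai * ((1 - a * bi) * u) * ((1 - q * a * b) * u) + bi * ((1 - b) * u) * ((1 - q * b) * u)"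
    by algebra
  moreover have "q powi (1 + int k) = q * a" "q powi (1 + int k + int j) = q * a * b"
      "q powi (1 + int j) = q * b" "q powi (int k - int j) = a * bi"
    by (simp_all add: defs power_int_add power_int_diff power_int_minus divide_inverse)
  ultimately show ?thesis
    by (simp only: dvar_def qint_def divide_inverse defs)
qed

text \<open>
  By \<open>dterm_Suc\<close> the first summand in \<open>dvar_shift\<close> turns \<open>dterm j k\<close> into a multiple of
  \<open>dterm (Suc j) k\<close>, and the second summand does not depend on \<open>k\<close>. The point is that both
  coefficients are then Laurent polynomials free of \<open>k\<close>, so they can be taken out of a sum
  over \<open>k\<close>.
\<close>

lemma dvar_mult_dterm:
  "dvar k * dterm j k = qint (1 + int j) ^ 2 * dterm (Suc j) k
     + q powi (- int j) * qint (int j) * qint (1 + int j) * dterm j k"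
  unfolding dterm_Suc by (subst dvar_shift[of k j]) (simp add: algebra_simps)

text \<open>
  With \<open>y = q\<^bsup>-k\<^esup> + q\<^bsup>k+1\<^esup>\<close> both sides are polynomials in \<open>y\<close>:
  \<open>(1 - q)\<^sup>2 x\<^sub>k = y - (1 + q)\<close>, and \<open>q\<^bsup>-2k\<^esup> (1 - q\<^bsup>2k+1\<^esup>)\<^sup>2 = y\<^sup>2 - 4q\<close>.
\<close>

lemma odd_qint_square:
  "(q powi (- int k) * qint (int (2 * k + 1))) ^ 2
     = (1 - q) ^ 2 * dvar k ^ 2 + 2 * (1 + q) * dvar k + 1"
proof -
  define a ai u where "a = q powi int k" and "ai = q powi (- int k)" and "u = inverse (1 - q)"
  note defs = this
  have "a * ai = 1" "(1 - q) * u = 1"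
    by (simp_all add: defs power_int_minus)
  hence "(ai * ((1 - q * a ^ 2) * u)) ^ 2 =
      (1 - q) ^ 2 * (ai * ((1 - a) * u) * ((1 - q * a) * u)) ^ 2
        + 2 * (1 + q) * (ai * ((1 - a) * u) * ((1 - q * a) * u)) + 1"
    by algebra
  moreover have "q powi (1 + int k) = q * a"
    by (simp add: defs power_int_add)
  moreover have "q powi (int (2 * k + 1)) = q * a ^ 2"
    by (simp only: defs power_int_of_nat) (simp add: power_mult [symmetric] mult.commute)
  ultimately show ?thesis
    by (simp only: dvar_def qint_def divide_inverse defs)
qed

section \<open>Divisibility by a q-integer\<close>

text \<open>
  The right-hand sides \<open>S\<^sub>n\<close> satisfy \<open>S\<^sub>0 = 0\<close> and \<open>S\<^sub>n\<^sub>+\<^sub>1 - S\<^sub>n = q\<^bsup>-n\<^esup> [2n + 1] T\<^sub>j(n)\<close>: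
  after division by common factors this is
  \<open>[n + 1] [n + j + 1] - q\<^bsup>j+1\<^esup> [n] [n - j] = [j + 1] [2n + 1]\<close>.
\<close>

lemma weighted_sum_dterm:
  "(\<Sum>k<n. q powi (- int k) * qint (int (2 * k + 1)) * dterm j k)
     = qint (int n) * (q powi ((1 + int j) * (1 - int n)) * qbinom (int n) (Suc j)
         * qbinom (int (n + j)) j)"
proof (induction n)
  case 0
  show ?case by simp
next
  case (Suc n)
  define A where "A = qbinom (int n) j"
  define B where "B = qbinom (int (n + j)) j"
  define c where "c = q powi (- ((1 + int j) * int n))"
  have A1: "qbinom (int (Suc n)) (Suc j) = A * qint (1 + int n) / qint (1 + int j)"
    using qbinom_Suc_Suc[of "int n" j] by (simp add: A_def field_simps add.commute)
  have A0: "qbinom (int n) (Suc j) = A * qint (int n - int j) / qint (1 + int j)"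
    using qbinom_Suc_right[of "int n" j] by (simp add: A_def field_simps)
  have B1: "qbinom (int (Suc n + j)) j = B * qint (1 + int n + int j) / qint (1 + int n)"
    using qbinom_Suc_left[of "int (n + j)" j] by (simp add: B_def field_simps algebra_simps)
  have c1: "q powi ((1 + int j) * (1 - int (Suc n))) = c"
    by (simp add: c_def)
  have c0: "q powi ((1 + int j) * (1 - int n)) = q powi (1 + int j) * c"
    by (simp add: c_def power_int_add [symmetric] algebra_simps)
  have T: "q powi (- int n) * dterm j n = c * A * B"
    by (simp add: dterm_def c_def A_def B_def power_int_add [symmetric] algebra_simps)
  have key: "qint (1 + int n) * qint (1 + int n + int j)
      - q powi (1 + int j) * qint (int n) * qint (int n - int j)
      = qint (1 + int j) * qint (int (2 * n + 1))"
  proof -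
    define a b bi u where "a = q powi int n" and "b = q powi int j"
      and "bi = q powi (- int j)" and "u = inverse (1 - q)"
    note defs = this
    have "b * bi = 1"
      by (simp add: defs power_int_minus)
    hence "(1 - q * a) * u * ((1 - q * a * b) * u) - q * b * ((1 - a) * u) * ((1 - a * bi) * u)
        = (1 - q * b) * u * ((1 - q * a ^ 2) * u)"
      by algebra
    moreover have "q powi (1 + int n) = q * a" "q powi (1 + int n + int j) = q * a * b"
        "q powi (1 + int j) = q * b" "q powi (int n - int j) = a * bi"
      by (simp_all add: defs power_int_add power_int_diff power_int_minus divide_inverse)
    moreover have "q powi (int (2 * n + 1)) = q * a ^ 2"
      by (simp only: defs power_int_of_nat) (simp add: power_mult [symmetric] mult.commute)
    ultimately show ?thesis
      by (simp only: qint_def divide_inverse defs)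
  qed
  have "(\<Sum>k<Suc n. q powi (- int k) * qint (int (2 * k + 1)) * dterm j k)
      = qint (int n) * (q powi (1 + int j) * c * (A * qint (int n - int j) / qint (1 + int j)) * B)
        + c * A * B * qint (int (2 * n + 1))"
    using Suc.IH T by (simp only: sum.lessThan_Suc A0 c0 B_def) (simp add: algebra_simps)
  also have "\<dots> = c * A * B * (q powi (1 + int j) * qint (int n) * qint (int n - int j)
        + qint (1 + int j) * qint (int (2 * n + 1))) / qint (1 + int j)"
    by (simp add: field_simps del: of_nat_add of_nat_mult of_nat_Suc)
  also have "\<dots> = c * A * B * (qint (1 + int n) * qint (1 + int n + int j)) / qint (1 + int j)"
    by (simp only: key [symmetric]) simp
  also have "\<dots> = qint (int (Suc n)) * (q powi ((1 + int j) * (1 - int (Suc n)))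
      * qbinom (int (Suc n)) (Suc j) * qbinom (int (Suc n + j)) j)"
    unfolding A1 B1 c1 by (simp add: field_simps)
  finally show ?case .
qed

text \<open>
  The ideal is taken in the ring of Laurent polynomials; in the ambient field a nonzero \<open>[n]\<close>
  generates everything.
\<close>

definition qideal :: "nat \<Rightarrow> ratfun set" where
  "qideal n = (\<lambda>d. qint (int n) * d) ` laurent_polys"

lemma qideal_add: "a \<in> qideal n \<Longrightarrow> b \<in> qideal n \<Longrightarrow> a + b \<in> qideal n"
  unfolding qideal_def by (force simp: distrib_left [symmetric])

lemma qideal_mult:
  assumes "c \<in> laurent_polys" "a \<in> qideal n"
  shows "c * a \<in> qideal n"
proof -
  from assms(2) obtain d where "d \<in> laurent_polys" "a = qint (int n) * d"
    by (auto simp: qideal_def)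
  with assms(1) show ?thesis
    by (auto simp: qideal_def intro!: image_eqI[of _ _ "c * d"])
qed

lemma qideal_sum: "(\<And>i. i \<in> I \<Longrightarrow> f i \<in> qideal n) \<Longrightarrow> sum f I \<in> qideal n"
proof (induction I rule: infinite_finite_induct)
  case (insert i I)
  thus ?case
    by (simp add: qideal_add)
qed (auto simp: qideal_def intro: image_eqI[of _ _ 0])

text \<open>
  Asking for all \<open>j\<close> at once is what makes the condition stable under multiplication by
  \<open>dvar\<close>, which sends \<open>dterm j\<close> to a combination with \<open>dterm (Suc j)\<close>. The multipliers thus
  form a module over the polynomials in \<open>dvar\<close> with Laurent polynomial coefficients.
\<close>

definition multiplier :: "nat \<Rightarrow> (nat \<Rightarrow> ratfun) \<Rightarrow> bool" where
  "multiplier n g \<longleftrightarrow> (\<forall>j. (\<Sum>k<n. g k * dterm j k) \<in> qideal n)"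

lemma multiplier_add:
  assumes "multiplier n f" "multiplier n g"
  shows "multiplier n (\<lambda>k. f k + g k)"
  using assms by (simp add: multiplier_def distrib_right sum.distrib qideal_add)

lemma multiplier_scale:
  assumes "c \<in> laurent_polys" "multiplier n g"
  shows "multiplier n (\<lambda>k. c * g k)"
  using assms by (simp add: multiplier_def mult.assoc sum_distrib_left [symmetric] qideal_mult)

lemma multiplier_dvar:
  assumes "multiplier n g"
  shows "multiplier n (\<lambda>k. dvar k * g k)"
  unfolding multiplier_def
proof
  fix j
  have "(\<Sum>k<n. dvar k * g k * dterm j k)
      = (\<Sum>k<n. g k * (dvar k * dterm j k))"
    by (simp add: mult_ac)
  also have "\<dots> = qint (1 + int j) ^ 2 * (\<Sum>k<n. g k * dterm (Suc j) k)
      + q powi (- int j) * qint (int j) * qint (1 + int j) * (\<Sum>k<n. g k * dterm j k)"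
    by (simp add: dvar_mult_dterm distrib_left sum.distrib sum_distrib_left mult_ac)
  also have "\<dots> \<in> qideal n"
    using assms unfolding multiplier_def
    by (intro qideal_add qideal_mult laurent_mult laurent_power) auto
  finally show "(\<Sum>k<n. dvar k * g k * dterm j k) \<in> qideal n" .
qed

text \<open>
  Raising the exponent by \<open>2\<close> multiplies the weight by a polynomial in \<open>dvar\<close>, by
  \<open>odd_qint_square\<close>, so only the exponent \<open>1\<close> needs the telescoping sum.
\<close>

lemma multiplier_odd_power:
  "multiplier n (\<lambda>k. (q powi (- int k) * qint (int (2 * k + 1))) ^ (2 * v + 1))"
proof (induction v)
  case 0
  have "(\<Sum>k<n. q powi (- int k) * qint (int (2 * k + 1)) * dterm j k) \<in> qideal n" for j
    unfolding weighted_sum_dterm qideal_def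
    by (intro imageI laurent_mult laurent_q_powi laurent_qbinom)
  thus ?case
    by (simp add: multiplier_def)
next
  case (Suc v)
  define g where "g = (\<lambda>k. (q powi (- int k) * qint (int (2 * k + 1))) ^ (2 * v + 1))"
  have "(q powi (- int k) * qint (int (2 * k + 1))) ^ (2 * Suc v + 1)
      = (1 - q) ^ 2 * (dvar k * (dvar k * g k)) + 2 * (1 + q) * (dvar k * g k) + g k" for k
  proof -
    have "(q powi (- int k) * qint (int (2 * k + 1))) ^ (2 * Suc v + 1)
        = (q powi (- int k) * qint (int (2 * k + 1))) ^ 2 * g k"
      unfolding g_def by (simp only: power_add [symmetric]) (simp add: algebra_simps)
    thus ?thesis
      unfolding odd_qint_square by (simp add: algebra_simps power2_eq_square)
  qed
  moreover have "(1 - q) ^ 2 \<in> laurent_polys" "2 * (1 + q) \<in> laurent_polys"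
  proof -
    show "(1 - q) ^ 2 \<in> laurent_polys"
      using laurent_add[OF laurent_1 laurent_uminus[OF laurent_q]] by auto
    have "2 * (1 + q) = (1 + q) + (1 + q)"
      by simp
    thus "2 * (1 + q) \<in> laurent_polys"
      using laurent_add[OF laurent_1 laurent_q] by (metis laurent_add)
  qed
  ultimately show ?case
    using Suc.IH by (simp only: g_def [symmetric] multiplier_add multiplier_scale multiplier_dvar)
qed

theorem theorem6:
  fixes v n :: nat
  assumes "n > 0"
  shows "laurent_cong
    (\<Sum>k=0..n-1. q ^ ((n - 1 - k) * (2 * v + 1)) * qint (int (2 * k + 1)) ^ (2 * v + 1) * qdelannoy k)
    0 (qint (int n))"
proof -
  define g where "g = (\<lambda>k. (q powi (- int k) * qint (int (2 * k + 1))) ^ (2 * v + 1))"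
  let ?S = "\<Sum>k=0..n-1. q ^ ((n - 1 - k) * (2 * v + 1)) * qint (int (2 * k + 1)) ^ (2 * v + 1) * qdelannoy k"
  have weight: "q ^ ((n - 1 - k) * (2 * v + 1)) * qint (int (2 * k + 1)) ^ (2 * v + 1)
      = q ^ ((n - 1) * (2 * v + 1)) * g k" if "k < n" for k
  proof -
    have "n - 1 = (n - 1 - k) + k"
      using that by simp
    hence "q ^ (n - 1) = q ^ (n - 1 - k) * q ^ k"
      by (metis power_add)
    hence "q ^ (n - 1 - k) = q ^ (n - 1) * q powi (- int k)"
      by (simp add: power_int_minus field_simps)
    thus ?thesis
      unfolding g_def power_mult by (simp only: power_mult_distrib mult.assoc)
  qed
  have "q ^ ((n - 1 - k) * (2 * v + 1)) * qint (int (2 * k + 1)) ^ (2 * v + 1) * qdelannoy k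
      = (\<Sum>j<n. q ^ ((n - 1) * (2 * v + 1)) * (q ^ (j choose 2) * (g k * dterm j k)))"
    if "k < n" for k
    unfolding weight[OF that] qdelannoy_eq_dterm[OF that] sum_distrib_left
    by (intro sum.cong refl) (simp only: mult_ac)
  moreover have "{0..n-1} = {..<n}"
    using assms by auto
  ultimately have "?S
      = (\<Sum>k<n. \<Sum>j<n. q ^ ((n - 1) * (2 * v + 1)) * (q ^ (j choose 2) * (g k * dterm j k)))"
    by simp
  also have "\<dots> = q ^ ((n - 1) * (2 * v + 1))
      * (\<Sum>j<n. q ^ (j choose 2) * (\<Sum>k<n. g k * dterm j k))"
    by (subst sum.swap) (simp add: sum_distrib_left)
  also have "\<dots> \<in> qideal n"
  proof -
    have "(\<Sum>k<n. g k * dterm j k) \<in> qideal n" for j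
      using multiplier_odd_power[of n v] unfolding multiplier_def g_def by blast
    hence "(\<Sum>j<n. q ^ (j choose 2) * (\<Sum>k<n. g k * dterm j k)) \<in> qideal n"
      by (rule qideal_sum[OF qideal_mult[OF laurent_q_power]])
    thus ?thesis
      by (rule qideal_mult[OF laurent_q_power])
  qed
  finally have "?S \<in> qideal n" .
  then obtain d where "d \<in> laurent_polys" "?S = qint (int n) * d"
    unfolding qideal_def by blast
  thus ?thesis
    unfolding laurent_cong_def by (metis diff_zero laurent_0 laurent_mult laurent_qint)
qed

end
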